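(* Let $s\ge1$ be an integer and let $W_0\hookrightarrow C_0^s(\mathbb{R}^3,\mathbb{R}^3)$ be a Hilbert space whose reproducing kernel is $K(x,y)=\mathbf{k}_{W_0}(x-y)$ with $\mathbf{k}_{W_0}(x)=k_{W_0}(\|x\|)\mathbb{I}_3$, $x\in\mathbb{R}^3$. Define $\mathbf{k}_V:=-\mathrm{curl}^{\mathrm C}\mathrm{curl}^{\mathrm R}\,\mathbf{k}_{W_0}$. Then, for $x\neq0$, $\mathbf{k}_V(x)=k_V^\parallel(\|x\|)\,\mathrm{Pr}_x^\parallel+k_V^\perp(\|x\|)\,\mathrm{Pr}_x^\perp$ with $$k_V^\parallel(r)=-\frac2r\frac{dk_{W_0}}{dr}(r)\qquad\text{and}\qquad k_V^\perp(r)=-\frac1r\frac{dk_{W_0}}{dr}(r)-\frac{d^2k_{W_0}}{dr^2}(r),\qquad r>0.$$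
   Context: $C_0^s(\mathbb{R}^3,\mathbb{R}^3)$ is the Banach space of $C^s$ functions all of whose partial derivatives of order at most $s$ vanish at infinity, with norm $\sum_{|p|\le s}\sup_x\|\partial^pu(x)\|$; $X\hookrightarrow Y$ means $X\subseteq Y$ with continuous inclusion. The reproducing kernel $K$ of $W_0$ satisfies $K(\cdot,x)\alpha\in W_0$ and $\langle K(\cdot,x)\alpha,u\rangle_{W_0}=\alpha\cdot u(x)$ for all $u\in W_0$, $x,\alpha\in\mathbb{R}^3$. (With these hypotheses $\mathbf{k}_{W_0}$ is twice differentiable.) For $\mathbf{g}:\mathbb{R}^3\to\mathbb{R}^{3\times3}$, $\mathrm{curl}^{\mathrm C}\mathbf{g}$ (resp. $\mathrm{curl}^{\mathrm R}\mathbf{g}$) is the matrix whose $i$-th column (resp. row) is the curl of the $i$-th column (resp. row) of $\mathbf{g}$. For $x\ne0$, $\mathrm{Pr}_x^\parallel:=xx^T/\|x\|^2$, $\mathrm{Pr}_x^\perp:=\mathbb{I}_3-xx^T/\|x\|^2$. *)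

theory Defs
  imports "HOL-Analysis.Analysis"
begin

section \<open>Partial derivatives and the spaces of \<open>C\<^sup>s\<close> functions vanishing at infinity\<close>

definition partial_deriv ::
  "3 \<Rightarrow> (real^3 \<Rightarrow> 'b::real_normed_vector) \<Rightarrow> real^3 \<Rightarrow> 'b" where
  "partial_deriv i f x = vector_derivative (\<lambda>t. f (x + t *\<^sub>R axis i 1)) (at 0)"

fun C_k :: "nat \<Rightarrow> (real^3 \<Rightarrow> real^3) \<Rightarrow> bool" where
  "C_k 0 f \<longleftrightarrow> continuous_on UNIV f"
| "C_k (Suc s) f \<longleftrightarrow> (\<forall>x. f differentiable (at x)) \<and> (\<forall>i. C_k s (partial_deriv i f))"

text \<open>A multi-index is an element of \<^typ>\<open>nat^3\<close>.\<close>

definition mi_order :: "nat^3 \<Rightarrow> nat" where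
  "mi_order p = (\<Sum>i\<in>UNIV. p $ i)"

definition mi_deriv ::
  "nat^3 \<Rightarrow> (real^3 \<Rightarrow> 'b::real_normed_vector) \<Rightarrow> real^3 \<Rightarrow> 'b" where
  "mi_deriv p f =
     (partial_deriv 1 ^^ (p $ 1)) ((partial_deriv 2 ^^ (p $ 2)) ((partial_deriv 3 ^^ (p $ 3)) f))"

definition C0_space :: "nat \<Rightarrow> (real^3 \<Rightarrow> real^3) set" where
  "C0_space s =
     {f. C_k s f \<and> (\<forall>p. mi_order p \<le> s \<longrightarrow> (mi_deriv p f \<longlongrightarrow> 0) at_infinity)}"

definition C0_norm :: "nat \<Rightarrow> (real^3 \<Rightarrow> real^3) \<Rightarrow> real" where
  "C0_norm s f = (\<Sum>p | mi_order p \<le> s. SUP x. norm (mi_deriv p f x))"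

text \<open>The index set of the sum above is finite, so the sum is not vacuously zero.\<close>

lemma finite_mi_order_le: "finite {p. mi_order p \<le> s}"
proof (rule finite_imageD[where f = vec_nth])
  have "p $ i \<le> s" if "mi_order p \<le> s" for p i
  proof -
    have "p $ i \<le> mi_order p"
      unfolding mi_order_def by (rule member_le_sum) auto
    with that show ?thesis by simp
  qed
  then have "vec_nth ` {p. mi_order p \<le> s} \<subseteq> (\<Pi>\<^sub>E i\<in>UNIV. {..s})"
    by auto
  then show "finite (vec_nth ` {p. mi_order p \<le> s})"
    by (rule finite_subset) (simp add: finite_PiE)
  show "inj_on vec_nth {p. mi_order p \<le> s}"
    by (simp add: inj_on_def vec_nth_inject)
qed

section \<open>Hilbert spaces of functions\<close>

text \<open>
  A real Hilbert space whose elements are functions with the pointwise vector space operations,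
  given by its carrier \<open>H\<close> and its inner product \<open>ip\<close> (relevant only on \<open>H\<close>).
\<close>

definition ip_norm :: "(('a \<Rightarrow> 'b) \<Rightarrow> ('a \<Rightarrow> 'b) \<Rightarrow> real) \<Rightarrow> ('a \<Rightarrow> 'b) \<Rightarrow> real" where
  "ip_norm ip u = sqrt (ip u u)"

locale function_hilbert_space =
  fixes H :: "('a \<Rightarrow> 'b::real_vector) set"
    and ip :: "('a \<Rightarrow> 'b) \<Rightarrow> ('a \<Rightarrow> 'b) \<Rightarrow> real"
  assumes zero_mem: "(\<lambda>x. 0) \<in> H"
    and add_mem: "u \<in> H \<Longrightarrow> v \<in> H \<Longrightarrow> (\<lambda>x. u x + v x) \<in> H"
    and scale_mem: "u \<in> H \<Longrightarrow> (\<lambda>x. c *\<^sub>R u x) \<in> H"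
    and ip_commute: "u \<in> H \<Longrightarrow> v \<in> H \<Longrightarrow> ip u v = ip v u"
    and ip_add_left:
      "u \<in> H \<Longrightarrow> v \<in> H \<Longrightarrow> w \<in> H \<Longrightarrow> ip (\<lambda>x. u x + v x) w = ip u w + ip v w"
    and ip_scale_left: "u \<in> H \<Longrightarrow> v \<in> H \<Longrightarrow> ip (\<lambda>x. c *\<^sub>R u x) v = c * ip u v"
    and ip_nonneg: "u \<in> H \<Longrightarrow> 0 \<le> ip u u"
    and ip_eq_0: "u \<in> H \<Longrightarrow> ip u u = 0 \<Longrightarrow> u = (\<lambda>x. 0)"
    and complete: "Metric_space.mcomplete H (\<lambda>u v. ip_norm ip (\<lambda>x. u x - v x))"

text \<open>
  The relation \<open>X \<hookrightarrow> Y\<close> for normed function spaces \<open>(X, nX)\<close> and \<open>(Y, nY)\<close>.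
\<close>

definition continuously_included ::
  "('a \<Rightarrow> 'b::real_vector) set \<Rightarrow> (('a \<Rightarrow> 'b) \<Rightarrow> real) \<Rightarrow>
   ('a \<Rightarrow> 'b) set \<Rightarrow> (('a \<Rightarrow> 'b) \<Rightarrow> real) \<Rightarrow> bool" where
  "continuously_included X nX Y nY \<longleftrightarrow>
     X \<subseteq> Y \<and>
     (\<forall>u\<in>X. \<forall>\<epsilon>>0. \<exists>\<delta>>0. \<forall>v\<in>X. nX (\<lambda>x. v x - u x) < \<delta> \<longrightarrow> nY (\<lambda>x. v x - u x) < \<epsilon>)"

definition is_reproducing_kernel ::
  "(real^3 \<Rightarrow> real^3) set \<Rightarrow> ((real^3 \<Rightarrow> real^3) \<Rightarrow> (real^3 \<Rightarrow> real^3) \<Rightarrow> real) \<Rightarrow>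
   (real^3 \<Rightarrow> real^3 \<Rightarrow> real^3^3) \<Rightarrow> bool" where
  "is_reproducing_kernel H ip K \<longleftrightarrow>
     (\<forall>x \<alpha>. (\<lambda>y. K y x *v \<alpha>) \<in> H \<and> (\<forall>u\<in>H. ip (\<lambda>y. K y x *v \<alpha>) u = \<alpha> \<bullet> u x))"

section \<open>Curl operators and projections\<close>

definition curl :: "(real^3 \<Rightarrow> real^3) \<Rightarrow> real^3 \<Rightarrow> real^3" where
  "curl f x = vector
     [partial_deriv 2 (\<lambda>y. f y $ 3) x - partial_deriv 3 (\<lambda>y. f y $ 2) x,
      partial_deriv 3 (\<lambda>y. f y $ 1) x - partial_deriv 1 (\<lambda>y. f y $ 3) x,
      partial_deriv 1 (\<lambda>y. f y $ 2) x - partial_deriv 2 (\<lambda>y. f y $ 1) x]"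

text \<open>In \<^typ>\<open>real^3^3\<close> the outer index is the row: \<open>A $ i $ j\<close> is in row \<open>i\<close>, column \<open>j\<close>.\<close>

definition curl_C :: "(real^3 \<Rightarrow> real^3^3) \<Rightarrow> real^3 \<Rightarrow> real^3^3" where
  "curl_C g x = (\<chi> i j. curl (\<lambda>y. column j (g y)) x $ i)"

definition curl_R :: "(real^3 \<Rightarrow> real^3^3) \<Rightarrow> real^3 \<Rightarrow> real^3^3" where
  "curl_R g x = (\<chi> i j. curl (\<lambda>y. row i (g y)) x $ j)"

definition Pr_par :: "real^3 \<Rightarrow> real^3^3" where
  "Pr_par x = (1 / (norm x)\<^sup>2) *\<^sub>R ((columnvector x :: real^1^3) ** rowvector x)"

definition Pr_perp :: "real^3 \<Rightarrow> real^3^3" where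
  "Pr_perp x = mat 1 - (1 / (norm x)\<^sup>2) *\<^sub>R ((columnvector x :: real^1^3) ** rowvector x)"

end

(*
The functional u |-> (d_i u(0))_1 is bounded on W_0 because W_0 embeds continuously into C_0^1. Its
representing element has first component y |-> (d_i phi)(-y), where phi(x) = k(|x|), and being a
limit in C_0^1 it is differentiable; so phi is one order smoother than the elements of W_0.
Then -curl^C curl^R (phi I) = Hess phi - (Laplace phi) I, where Hess phi = k'' Pr_par + (k'/r) Pr_perp
and Laplace phi = k'' + 2k'/r.
*)
theory Submission
  imports Defs
begin

section \<open>Partial derivatives\<close>

lemma partial_deriv_has_derivative:
  assumes "(f has_derivative f') (at x)"
  shows "partial_deriv i f x = f' (axis i 1)"
proof -
  have f': "(f has_derivative f') (at (x + 0 *\<^sub>R axis i 1))"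
    using assms by simp
  have "((\<lambda>t. x + t *\<^sub>R axis i 1) has_derivative (\<lambda>t. t *\<^sub>R axis i 1)) (at 0)"
    by (auto intro!: derivative_eq_intros)
  from has_derivative_compose[OF this f']
  have "((\<lambda>t. f (x + t *\<^sub>R axis i 1)) has_derivative (\<lambda>t. f' (t *\<^sub>R axis i 1))) (at 0)" .
  then have "((\<lambda>t. f (x + t *\<^sub>R axis i 1)) has_vector_derivative f' (axis i 1)) (at 0)"
    unfolding has_vector_derivative_def
    by (simp add: linear_scale[OF has_derivative_linear[OF assms]])
  then show ?thesis
    unfolding partial_deriv_def by (rule vector_derivative_at)
qed

lemma partial_deriv_bounded_linear:
  assumes "bounded_linear T" and "f differentiable (at x)"
  shows "partial_deriv i (\<lambda>y. T (f y)) x = T (partial_deriv i f x)"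
proof -
  obtain f' where f': "(f has_derivative f') (at x)"
    using assms(2) unfolding differentiable_def by blast
  show ?thesis
    using partial_deriv_has_derivative[OF bounded_linear.has_derivative[OF assms(1) f']]
      partial_deriv_has_derivative[OF f'] by simp
qed

lemma partial_deriv_add:
  assumes "f differentiable (at x)" and "g differentiable (at x)"
  shows "partial_deriv i (\<lambda>y. f y + g y) x = partial_deriv i f x + partial_deriv i g x"
proof -
  obtain f' g' where f': "(f has_derivative f') (at x)" and g': "(g has_derivative g') (at x)"
    using assms unfolding differentiable_def by blast
  show ?thesis
    using partial_deriv_has_derivative[OF has_derivative_add[OF f' g']]
      partial_deriv_has_derivative[OF f'] partial_deriv_has_derivative[OF g'] by simp
qed

lemma partial_deriv_diff:
  assumes "f differentiable (at x)" and "g differentiable (at x)"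
  shows "partial_deriv i (\<lambda>y. f y - g y) x = partial_deriv i f x - partial_deriv i g x"
proof -
  obtain f' g' where f': "(f has_derivative f') (at x)" and g': "(g has_derivative g') (at x)"
    using assms unfolding differentiable_def by blast
  show ?thesis
    using partial_deriv_has_derivative[OF has_derivative_diff[OF f' g']]
      partial_deriv_has_derivative[OF f'] partial_deriv_has_derivative[OF g'] by simp
qed

lemma partial_deriv_translate:
  "partial_deriv i (\<lambda>z. f (z - y)) x = partial_deriv i f (x - y)"
  unfolding partial_deriv_def by (simp add: algebra_simps)

lemma partial_deriv_minus:
  assumes "f differentiable (at x)"
  shows "partial_deriv i (\<lambda>y. - f y) x = - partial_deriv i f x"
  by (rule partial_deriv_bounded_linear[OF bounded_linear_minus[OF bounded_linear_ident] assms])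

lemma partial_deriv_scaleR:
  assumes "f differentiable (at x)"
  shows "partial_deriv i (\<lambda>y. c *\<^sub>R f y) x = c *\<^sub>R partial_deriv i f x"
  by (rule partial_deriv_bounded_linear[OF bounded_linear_scaleR_right assms])

lemma partial_deriv_nth:
  fixes f :: "real^3 \<Rightarrow> real^'n"
  assumes "f differentiable (at x)"
  shows "partial_deriv i (\<lambda>y. f y $ j) x = partial_deriv i f x $ j"
  by (rule partial_deriv_bounded_linear[OF bounded_linear_vec_nth assms])

lemma partial_deriv_const [simp]: "partial_deriv i (\<lambda>y. c) x = 0"
  unfolding partial_deriv_def by simp

text \<open>Makes the total derivative explicit in the partial derivatives, so that
  \<open>differentiable_limit\<close> can read convergence of derivatives off convergence of
  partials.\<close>

lemma has_derivative_partial_deriv: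
  assumes "f differentiable (at x)"
  shows "(f has_derivative (\<lambda>h. \<Sum>i\<in>UNIV. h $ i *\<^sub>R partial_deriv i f x)) (at x)"
proof -
  obtain f' where f': "(f has_derivative f') (at x)"
    using assms unfolding differentiable_def by blast
  have lin: "linear f'"
    using f' by (rule has_derivative_linear)
  have "f' h = (\<Sum>i\<in>UNIV. h $ i *\<^sub>R partial_deriv i f x)" for h
  proof -
    have "h = (\<Sum>i\<in>UNIV. h $ i *\<^sub>R axis i 1)"
      using basis_expansion[of h] by (simp add: scalar_mult_eq_scaleR)
    then have "f' h = f' (\<Sum>i\<in>UNIV. h $ i *\<^sub>R axis i 1)"
      by simp
    also have "\<dots> = (\<Sum>i\<in>UNIV. h $ i *\<^sub>R f' (axis i 1))"
      by (simp add: linear_sum[OF lin] linear_scale[OF lin])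
    finally show ?thesis
      by (simp add: partial_deriv_has_derivative[OF f'])
  qed
  then have "f' = (\<lambda>h. \<Sum>i\<in>UNIV. h $ i *\<^sub>R partial_deriv i f x)" ..
  with f' show ?thesis
    by simp
qed

text \<open>Uniformly Cauchy partials converge uniformly to some \<open>P i\<close>, hence the total
  derivatives converge uniformly in operator norm. Together with pointwise convergence of the
  functions this permits differentiation of the limit.\<close>

lemma differentiable_limit:
  fixes w :: "nat \<Rightarrow> real^3 \<Rightarrow> 'b::banach"
  assumes diff: "\<And>n x. w n differentiable (at x)"
    and cauchy: "\<And>i. uniformly_Cauchy_on UNIV (\<lambda>n. partial_deriv i (w n))"
    and lim: "\<And>x. (\<lambda>n. w n x) \<longlonglongrightarrow> g x"
  shows "g differentiable (at x)"
proof -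
  obtain P where P: "\<And>i. uniform_limit UNIV (\<lambda>n. partial_deriv i (w n)) (P i) sequentially"
    using Cauchy_uniformly_convergent[OF cauchy] unfolding uniformly_convergent_on_def by metis
  have conv: "\<forall>\<^sub>F n in sequentially. \<forall>x\<in>UNIV. \<forall>h. norm
      ((\<Sum>i\<in>UNIV. h $ i *\<^sub>R partial_deriv i (w n) x) - (\<Sum>i\<in>UNIV. h $ i *\<^sub>R P i x)) \<le> e * norm h"
    if "e > 0" for e :: real
  proof -
    \<comment> \<open>Each of the three coordinates contributes at most
      \<open>norm h * (e / 3)\<close>, because a component of \<open>h\<close> is bounded by its
      norm.\<close>
    have "\<forall>\<^sub>F n in sequentially. \<forall>i. \<forall>x\<in>UNIV. dist (partial_deriv i (w n) x) (P i x) < e / 3"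
      using that by (intro eventually_all_finite uniform_limitD[OF P]) simp
    then show ?thesis
    proof (rule eventually_mono, intro ballI allI)
      fix n x and h :: "real^3"
      assume n: "\<forall>i. \<forall>x\<in>UNIV. dist (partial_deriv i (w n) x) (P i x) < e / 3"
      have "norm ((\<Sum>i\<in>UNIV. h $ i *\<^sub>R partial_deriv i (w n) x) - (\<Sum>i\<in>UNIV. h $ i *\<^sub>R P i x))
          = norm (\<Sum>i\<in>UNIV. h $ i *\<^sub>R (partial_deriv i (w n) x - P i x))"
        by (simp add: sum_subtractf scaleR_diff_right)
      also have "\<dots> \<le> (\<Sum>i\<in>(UNIV::3 set). norm h * (e / 3))"
      proof (rule sum_norm_le)
        fix i :: 3
        have "\<bar>h $ i\<bar> * norm (partial_deriv i (w n) x - P i x) \<le> norm h * (e / 3)"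
          using n by (intro mult_mono component_le_norm_cart) (auto simp: dist_norm less_imp_le)
        then show "norm (h $ i *\<^sub>R (partial_deriv i (w n) x - P i x)) \<le> norm h * (e / 3)"
          by simp
      qed
      finally show "norm ((\<Sum>i\<in>UNIV. h $ i *\<^sub>R partial_deriv i (w n) x) - (\<Sum>i\<in>UNIV. h $ i *\<^sub>R P i x))
          \<le> e * norm h"
        by (simp add: mult.commute)
    qed
  qed
  have "\<exists>g'. \<forall>x\<in>UNIV. (\<lambda>n. w n x) \<longlonglongrightarrow> g' x \<and>
      (g' has_derivative (\<lambda>h. \<Sum>i\<in>UNIV. h $ i *\<^sub>R P i x)) (at x within UNIV)"
    by (rule has_derivative_sequence[OF convex_UNIV _ conv UNIV_I lim])
      (rule has_derivative_partial_deriv[OF diff])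
  then obtain g' where "\<forall>x. (\<lambda>n. w n x) \<longlonglongrightarrow> g' x \<and>
      (g' has_derivative (\<lambda>h. \<Sum>i\<in>UNIV. h $ i *\<^sub>R P i x)) (at x)"
    by auto
  \<comment> \<open>The sequence theorem produces its own limit function; uniqueness of pointwise
    limits identifies it with \<open>g\<close>.\<close>
  moreover from this have "g' = g"
    using lim LIMSEQ_unique by blast
  ultimately show ?thesis
    unfolding differentiable_def by auto
qed

section \<open>The embedding into \<open>C0_space\<close>\<close>

lemma C_k_continuous: "C_k s f \<Longrightarrow> continuous_on UNIV f"
  by (cases s)
    (auto intro!: continuous_at_imp_continuous_on differentiable_imp_continuous_within)

lemma C_k_funpow_partial_deriv:
  "C_k (n + s) f \<Longrightarrow> C_k s ((partial_deriv i ^^ n) f)"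
  by (induction n arbitrary: f) (simp_all add: funpow_swap1)

lemma C_k_mi_deriv:
  assumes "C_k s f" and "mi_order p \<le> s"
  shows "continuous_on UNIV (mi_deriv p f)"
proof -
  \<comment> \<open>The order is split to match the nesting in \<open>mi_deriv\<close>: derivatives
    in direction 3 are taken first, those in direction 1 last, and \<open>d\<close> orders
    remain.\<close>
  obtain d where s: "s = p $ 3 + (p $ 2 + (p $ 1 + d))"
    using assms(2) unfolding mi_order_def UNIV_3 by (auto simp: le_iff_add add_ac)
  show ?thesis
    unfolding mi_deriv_def
    using assms(1)[unfolded s] by (intro C_k_continuous[where s = d] C_k_funpow_partial_deriv)
qed

text \<open>The function is small outside a ball and bounded on the compact ball. This makes the
  suprema in \<open>C0_norm\<close> genuine upper bounds, as \<open>SUP\<close> over an unbounded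
  set of reals would carry no information.\<close>

lemma bdd_above_norm_vanishing_at_infinity:
  fixes f :: "'a::{heine_borel, real_normed_vector} \<Rightarrow> 'b::real_normed_vector"
  assumes "continuous_on UNIV f" and "(f \<longlongrightarrow> 0) at_infinity"
  shows "bdd_above (range (\<lambda>x. norm (f x)))"
proof -
  have "\<forall>\<^sub>F x in at_infinity. norm (f x) < 1"
    using tendstoD[OF assms(2), of 1] by simp
  then obtain b where b: "\<And>x. b \<le> norm x \<Longrightarrow> norm (f x) < 1"
    unfolding eventually_at_infinity by blast
  have "compact (f ` cball 0 b)"
    using assms(1) by (intro compact_continuous_image compact_cball) (auto intro: continuous_on_subset)
  then have "bounded (f ` cball 0 b)"
    by (rule compact_imp_bounded)
  then obtain B where "\<forall>x\<in>cball 0 b. norm (f x) \<le> B"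
    unfolding bounded_iff by blast
  then have B: "norm (f x) \<le> B" if "norm x \<le> b" for x
    using that by simp
  have "norm (f x) \<le> max B 1" for x
    using b[of x] B[of x] by linarith
  then show ?thesis
    by (rule bdd_aboveI2)
qed

text \<open>The multi-index \<open>axis i 1\<close> has order 1, so its supremum is one of the
  nonnegative summands of \<open>C0_norm\<close>.\<close>

lemma norm_partial_deriv_le_C0_norm:
  assumes "f \<in> C0_space s" and "s \<ge> 1"
  shows "norm (partial_deriv i f x) \<le> C0_norm s f"
proof -
  define S where "S p = (SUP x. norm (mi_deriv p f x))" for p
  have upper: "norm (mi_deriv p f x) \<le> S p" if "mi_order p \<le> s" for p x
    unfolding S_def using assms(1) that
    by (intro cSUP_upper bdd_above_norm_vanishing_at_infinity C_k_mi_deriv)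
      (auto simp: C0_space_def)
  have nonneg: "0 \<le> S p" if "mi_order p \<le> s" for p
    using upper[OF that, of 0] norm_ge_zero order_trans by blast
  have order: "mi_order (axis i 1) \<le> s"
    using assms(2) by (simp add: mi_order_def axis_def)
  have "mi_deriv (axis i 1) f = partial_deriv i f"
    using exhaust_3[of i] by (auto simp: mi_deriv_def axis_def)
  then have "norm (partial_deriv i f x) \<le> S (axis i 1)"
    using upper[OF order, of x] by simp
  also have "\<dots> \<le> (\<Sum>p | mi_order p \<le> s. S p)"
    using order nonneg by (intro member_le_sum finite_mi_order_le) auto
  finally show ?thesis
    by (simp add: C0_norm_def S_def)
qed

lemma C0_space_differentiable:
  assumes "f \<in> C0_space s" and "s \<ge> 1"
  shows "f differentiable (at x)"
  using assms by (cases s) (auto simp: C0_space_def)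

section \<open>Riesz representation by Cauchy sequences\<close>

text \<open>Evaluates the quadratic at its vertex \<open>- a / b\<close>. It turns near-minimality
  into a bound on the linear coefficient, as in the proof of Cauchy-Schwarz.\<close>

lemma nonneg_quadratic_discriminant:
  fixes a b c :: real
  assumes "\<And>t. 0 \<le> c + 2 * t * a + t\<^sup>2 * b" and "0 \<le> b"
  shows "a\<^sup>2 \<le> c * b"
proof (cases "b = 0")
  case True
  \<comment> \<open>With \<open>b = 0\<close> the expression is affine in \<open>t\<close>; if
    \<open>a\<close> were nonzero, this choice of \<open>t\<close> would give it the value
    -1.\<close>
  then have "0 \<le> c + 2 * (- (c + 1) / (2 * a)) * a"
    using assms(1)[of "- (c + 1) / (2 * a)"] by simp
  then have "a = 0"
    by (cases "a = 0") (auto simp: field_simps)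
  with True show ?thesis
    by simp
next
  case False
  then have "0 \<le> (c + 2 * (- a / b) * a + (- a / b)\<^sup>2 * b) * b"
    using assms(1)[of "- a / b"] assms(2) by (intro mult_nonneg_nonneg)
  also have "\<dots> = c * b - a\<^sup>2"
    using False by (simp add: field_simps power2_eq_square)
  finally show ?thesis
    by simp
qed

context function_hilbert_space
begin

lemma ip_add_right:
  assumes "u \<in> H" "v \<in> H" "w \<in> H"
  shows "ip w (\<lambda>x. u x + v x) = ip w u + ip w v"
  using assms ip_add_left[of u v w] ip_commute add_mem by metis

lemma ip_scale_right:
  assumes "u \<in> H" "v \<in> H"
  shows "ip v (\<lambda>x. c *\<^sub>R u x) = c * ip v u"
  using assms ip_scale_left[of u v c] ip_commute scale_mem by metis

lemma diff_mem:
  assumes "u \<in> H" "v \<in> H"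
  shows "(\<lambda>x. u x - v x) \<in> H"
  using add_mem[OF assms(1) scale_mem[OF assms(2), of "-1"]] by simp

lemma ip_add_scale:
  assumes "u \<in> H" "v \<in> H"
  shows "ip (\<lambda>x. u x + t *\<^sub>R v x) (\<lambda>x. u x + t *\<^sub>R v x) = ip u u + 2 * t * ip u v + t\<^sup>2 * ip v v"
proof -
  have tv: "(\<lambda>x. t *\<^sub>R v x) \<in> H"
    using assms(2) by (rule scale_mem)
  show ?thesis
    using assms tv ip_commute[OF assms]
    by (simp add: ip_add_left ip_add_right add_mem ip_scale_left ip_scale_right
        power2_eq_square algebra_simps)
qed

lemma ip_norm_nonneg: "u \<in> H \<Longrightarrow> 0 \<le> ip_norm ip u"
  by (simp add: ip_norm_def ip_nonneg)

lemma ip_norm_square: "u \<in> H \<Longrightarrow> (ip_norm ip u)\<^sup>2 = ip u u"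
  by (simp add: ip_norm_def ip_nonneg)

lemma ip_norm_scale: "u \<in> H \<Longrightarrow> ip_norm ip (\<lambda>x. c *\<^sub>R u x) = \<bar>c\<bar> * ip_norm ip u"
  by (simp add: ip_norm_def ip_scale_left ip_scale_right scale_mem real_sqrt_mult
      flip: mult.assoc power2_eq_square)

text \<open>
  The constant \<^const>\<open>Metric_space.mcomplete\<close> can only be unfolded for functions that are nonnegative
  and symmetric on the whole type, which the distance of \<open>H\<close> need not be outside of \<open>H\<close>.
  Hence the representing element is replaced by a Cauchy sequence: a minimising sequence of
  \<open>u \<mapsto> ip u u - 2 * L u\<close>.
\<close>

lemma riesz_Cauchy_sequence:
  assumes add: "\<And>u v. u \<in> H \<Longrightarrow> v \<in> H \<Longrightarrow> L (\<lambda>x. u x + v x) = L u + L v"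
    and scale: "\<And>c u. u \<in> H \<Longrightarrow> L (\<lambda>x. c *\<^sub>R u x) = c * L u"
    and bound: "\<And>u. u \<in> H \<Longrightarrow> \<bar>L u\<bar> \<le> C * ip_norm ip u"
  obtains w :: "nat \<Rightarrow> 'a \<Rightarrow> 'b" where
    "\<And>n. w n \<in> H"
    "\<And>e. e > 0 \<Longrightarrow> \<exists>N. \<forall>m\<ge>N. \<forall>n\<ge>N. ip_norm ip (\<lambda>x. w m x - w n x) < e"
    "\<And>v. v \<in> H \<Longrightarrow> (\<lambda>n. ip (w n) v) \<longlonglongrightarrow> L v"
proof -
  define J where "J u = ip u u - 2 * L u" for u
  \<comment> \<open>On a line \<open>J\<close> is a quadratic polynomial whose linear coefficient
    measures how far \<open>u\<close> is from representing \<open>L\<close> in direction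
    \<open>v\<close>.\<close>
  have J_line: "J (\<lambda>x. u x + t *\<^sub>R v x) = J u + 2 * t * (ip u v - L v) + t\<^sup>2 * ip v v"
    if "u \<in> H" "v \<in> H" for u v t
    using that by (simp add: J_def ip_add_scale add scale scale_mem algebra_simps)
  \<comment> \<open>Completing the square bounds \<open>J\<close> from below, so its infimum
    \<open>m\<close> is meaningful.\<close>
  have J_ge: "- C\<^sup>2 \<le> J u" if "u \<in> H" for u
  proof -
    have "J u \<ge> (ip_norm ip u)\<^sup>2 - 2 * (C * ip_norm ip u)"
      using bound[OF that] by (simp add: J_def ip_norm_square[OF that])
    moreover have "(ip_norm ip u)\<^sup>2 - 2 * (C * ip_norm ip u) + C\<^sup>2 = (ip_norm ip u - C)\<^sup>2"
      by (simp add: power2_diff)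
    ultimately show ?thesis
      by (smt (verit) zero_le_power2)
  qed
  define m where "m = Inf (J ` H)"
  have m_le: "m \<le> J u" if "u \<in> H" for u
    unfolding m_def using that J_ge by (intro cInf_lower bdd_belowI2) auto
  have "\<exists>u\<in>H. J u < m + inverse (real (Suc n))" for n
  proof -
    have "J ` H \<noteq> {}"
      using zero_mem by blast
    then show ?thesis
      using cInf_lessD[of "J ` H" "m + inverse (real (Suc n))"] unfolding m_def by auto
  qed
  then obtain w where w: "\<And>n. w n \<in> H" and Jw: "\<And>n. J (w n) < m + inverse (real (Suc n))"
    by metis
  \<comment> \<open>Strong convexity: with \<open>d = v - u\<close>, the value of \<open>J\<close>
    at the midpoint of \<open>u\<close> and \<open>v\<close> is at least \<open>m\<close>.
    Eliminating the linear term between the expansions at parameters 1 and 1/2 bounds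
    \<open>ip d d\<close>.\<close>
  have parallelogram: "ip (\<lambda>x. v x - u x) (\<lambda>x. v x - u x) \<le> 2 * (J u - m) + 2 * (J v - m)"
    if "u \<in> H" "v \<in> H" for u v
  proof -
    define d where "d = (\<lambda>x. v x - u x)"
    have d: "d \<in> H"
      unfolding d_def using that by (intro diff_mem)
    have "J v = J u + 2 * (ip u d - L d) + ip d d"
      using J_line[OF that(1) d, of 1] by (simp add: d_def)
    moreover have "m \<le> J u + (ip u d - L d) + ip d d / 4"
      using J_line[OF that(1) d, of "1/2"] m_le[OF add_mem[OF that(1) scale_mem[OF d]], of "1/2"]
      by (simp add: power2_eq_square)
    ultimately have "ip d d \<le> 2 * (J u - m) + 2 * (J v - m)"
      by (simp add: field_simps)
    then show ?thesis
      by (simp add: d_def)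
  qed
  show thesis
  proof (rule that)
    show "w n \<in> H" for n
      by (rule w)
    show "\<exists>N. \<forall>m\<ge>N. \<forall>n\<ge>N. ip_norm ip (\<lambda>x. w m x - w n x) < e" if "e > 0" for e
    proof -
      \<comment> \<open>Both endpoints exceed the infimum by less than \<open>e\<^sup>2 / 4\<close>,
        and each excess enters the bound with factor 2.\<close>
      obtain N where N: "inverse (real (Suc N)) < e\<^sup>2 / 4"
        using reals_Archimedean[of "e\<^sup>2 / 4"] \<open>e > 0\<close> by auto
      have "ip_norm ip (\<lambda>x. w k x - w n x) < e" if "k \<ge> N" "n \<ge> N" for k n
      proof -
        have small: "J (w i) - m < e\<^sup>2 / 4" if "i \<ge> N" for i
        proof -
          have "inverse (real (Suc i)) \<le> inverse (real (Suc N))"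
            using that by (intro le_imp_inverse_le) auto
          then show ?thesis
            using Jw[of i] N by linarith
        qed
        have "ip (\<lambda>x. w k x - w n x) (\<lambda>x. w k x - w n x) \<le> 2 * (J (w n) - m) + 2 * (J (w k) - m)"
          by (rule parallelogram[OF w w])
        also have "\<dots> < e\<^sup>2"
          using small[OF that(1)] small[OF that(2)] by (simp add: field_simps)
        finally show ?thesis
          unfolding ip_norm_def using \<open>e > 0\<close> by (intro real_less_lsqrt) auto
      qed
      then show ?thesis by blast
    qed
    show "(\<lambda>n. ip (w n) v) \<longlonglongrightarrow> L v" if v: "v \<in> H" for v
    proof -
      \<comment> \<open>Moving from \<open>w n\<close> along \<open>v\<close> can lower
        \<open>J\<close> by at most \<open>inverse (real (Suc n))\<close>, so adding this constant
        makes the increment a nonnegative quadratic in \<open>t\<close>, and the discriminant bound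
        applies.\<close>
      have le: "(ip (w n) v - L v)\<^sup>2 \<le> inverse (real (Suc n)) * ip v v" for n
      proof (rule nonneg_quadratic_discriminant)
        fix t
        show "0 \<le> inverse (real (Suc n)) + 2 * t * (ip (w n) v - L v) + t\<^sup>2 * ip v v"
          using m_le[OF add_mem[OF w scale_mem[OF v]], of n t] J_line[OF w v, of n t] Jw[of n]
          by linarith
      qed (rule ip_nonneg[OF v])
      have lim0: "(\<lambda>n. inverse (real (Suc n)) * ip v v) \<longlonglongrightarrow> 0"
        using tendsto_mult_left_zero[OF LIMSEQ_inverse_real_of_nat] .
      have "(\<lambda>n. (ip (w n) v - L v)\<^sup>2) \<longlonglongrightarrow> 0"
        by (rule tendsto_sandwich[OF _ _ tendsto_const lim0]) (simp_all only: le zero_le_power2 eventually_True)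
      from tendsto_real_sqrt[OF this] have "(\<lambda>n. \<bar>ip (w n) v - L v\<bar>) \<longlonglongrightarrow> 0"
        by simp
      then show ?thesis
        by (rule LIM_zero_cancel[OF tendsto_rabs_zero_cancel])
    qed
  qed
qed

end

section \<open>Regularity of the kernel\<close>

text \<open>Continuity of the inclusion at the zero function becomes a linear bound by homogeneity:
  a nonzero \<open>u\<close> is rescaled to norm \<delta>/2, where its \<open>C0_norm\<close> is
  below 1. Positive definiteness covers norm zero.\<close>

lemma continuously_included_partial_deriv_bound:
  assumes "function_hilbert_space W0 ip"
    and incl: "continuously_included W0 (ip_norm ip) (C0_space s) (C0_norm s)"
    and s: "s \<ge> 1"
  obtains C where "\<And>u i x. u \<in> W0 \<Longrightarrow> norm (partial_deriv i u x) \<le> C * ip_norm ip u" "C > 0"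
proof -
  interpret function_hilbert_space W0 ip by fact
  have "\<exists>\<delta>>0. \<forall>v\<in>W0. ip_norm ip (\<lambda>x. v x - 0) < \<delta> \<longrightarrow> C0_norm s (\<lambda>x. v x - 0) < 1"
    using incl[unfolded continuously_included_def, THEN conjunct2, rule_format, OF zero_mem zero_less_one]
    by simp
  then obtain \<delta> where "\<delta> > 0" and \<delta>: "\<And>v. v \<in> W0 \<Longrightarrow> ip_norm ip v < \<delta> \<Longrightarrow> C0_norm s v < 1"
    by auto
  have sub: "u \<in> W0 \<Longrightarrow> u \<in> C0_space s" for u
    using incl unfolding continuously_included_def by blast
  have "norm (partial_deriv i u x) \<le> 2 / \<delta> * ip_norm ip u" if u: "u \<in> W0" for u i x
  proof (cases "ip_norm ip u = 0")
    case True
    then have "u = (\<lambda>x. 0)"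
      using u ip_norm_square[OF u] ip_eq_0 by simp
    with True show ?thesis by simp
  next
    case False
    define c where "c = \<delta> / (2 * ip_norm ip u)"
    have pos: "ip_norm ip u > 0"
      using False ip_norm_nonneg[OF u] by linarith
    have c: "c > 0"
      using pos \<open>\<delta> > 0\<close> by (simp add: c_def)
    have cu: "(\<lambda>x. c *\<^sub>R u x) \<in> W0"
      using u by (rule scale_mem)
    have "ip_norm ip (\<lambda>x. c *\<^sub>R u x) < \<delta>"
      using pos \<open>\<delta> > 0\<close> c by (simp add: ip_norm_scale[OF u] abs_of_pos c_def)
    from \<delta>[OF cu this] have "norm (partial_deriv i (\<lambda>x. c *\<^sub>R u x) x) < 1"
      using norm_partial_deriv_le_C0_norm[OF sub[OF cu] s, of i x] by linarith
    then have "c * norm (partial_deriv i u x) < 1"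
      using c by (simp add: partial_deriv_scaleR[OF C0_space_differentiable[OF sub[OF u] s]])
    then have "norm (partial_deriv i u x) < 1 / c"
      using c by (simp add: pos_less_divide_eq mult.commute)
    then show ?thesis
      by (simp add: c_def)
  qed
  then show thesis
    by (rule that) (simp_all add: \<open>\<delta> > 0\<close>)
qed

lemma scalar_kernel_twice_differentiable:
  fixes \<phi> :: "real^3 \<Rightarrow> real"
  assumes hilbert: "function_hilbert_space W0 ip"
    and incl: "continuously_included W0 (ip_norm ip) (C0_space s) (C0_norm s)"
    and s: "s \<ge> 1"
    and kernel: "is_reproducing_kernel W0 ip K"
    and K: "\<And>x y. K x y = \<phi> (x - y) *\<^sub>R mat 1"
  shows "\<phi> differentiable (at x)" and "partial_deriv i \<phi> differentiable (at x)"
proof -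
  interpret function_hilbert_space W0 ip by fact
  have diff: "u differentiable (at x)" if "u \<in> W0" for u x
  proof -
    have "u \<in> C0_space s"
      using incl that unfolding continuously_included_def by blast
    then show ?thesis
      using s by (rule C0_space_differentiable)
  qed
  obtain C where C: "\<And>u i x. u \<in> W0 \<Longrightarrow> norm (partial_deriv i u x) \<le> C * ip_norm ip u" and "C > 0"
    by (rule continuously_included_partial_deriv_bound[OF hilbert incl s]) blast
  define e :: "real^3" where "e = axis 1 1"
  have Kv: "K y x *v \<alpha> = \<phi> (y - x) *\<^sub>R \<alpha>" for x y \<alpha>
    by (simp add: K flip: scaleR_matrix_vector_assoc)
  have mem: "(\<lambda>y. \<phi> (y - x) *\<^sub>R \<alpha>) \<in> W0" for x \<alpha>
    using kernel unfolding is_reproducing_kernel_def Kv by blast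
  have reproduce: "ip u (\<lambda>y. \<phi> (y - x) *\<^sub>R \<alpha>) = \<alpha> \<bullet> u x" if "u \<in> W0" for u x \<alpha>
    using kernel that ip_commute[OF that mem] unfolding is_reproducing_kernel_def Kv by simp
  have nth: "(\<lambda>y. u y $ 1) differentiable (at x)" if "u \<in> W0" for u x
    using diff[OF that] by (rule differentiable_compose[rotated])
      (intro bounded_linear_imp_differentiable bounded_linear_vec_nth)
  \<comment> \<open>\<phi> is the first component of the kernel function centred at 0 in direction
    \<open>e\<close>, which belongs to \<open>W0\<close>.\<close>
  show \<phi>: "\<phi> differentiable (at x)" for x
    using nth[OF mem[of 0 e]] by (simp add: e_def axis_def)
  show "partial_deriv i \<phi> differentiable (at x)"
  proof -
    \<comment> \<open>The sequence \<open>w\<close> takes the place of the representing element of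
      the functional; \<open>C\<close> bounds this functional on \<open>W0\<close>.\<close>
    obtain w where w: "\<And>n. w n \<in> W0"
      and cauchy: "\<And>e. e > 0 \<Longrightarrow> \<exists>N. \<forall>m\<ge>N. \<forall>n\<ge>N. ip_norm ip (\<lambda>x. w m x - w n x) < e"
      and lim: "\<And>v. v \<in> W0 \<Longrightarrow> (\<lambda>n. ip (w n) v) \<longlonglongrightarrow> partial_deriv i v 0 $ 1"
    proof (rule riesz_Cauchy_sequence[of "\<lambda>u. partial_deriv i u 0 $ 1" C])
      show "\<bar>partial_deriv i u 0 $ 1\<bar> \<le> C * ip_norm ip u" if "u \<in> W0" for u
        by (rule order_trans[OF component_le_norm_cart C[OF that]])
    qed (use diff in \<open>auto simp: partial_deriv_add partial_deriv_scaleR\<close>)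
    have "(\<lambda>y. partial_deriv i \<phi> (- y)) differentiable (at y)" for y
    proof (rule differentiable_limit[where w = "\<lambda>n y. w n y $ 1"])
      show "(\<lambda>y. w n y $ 1) differentiable (at x)" for n x
        by (rule nth[OF w])
      \<comment> \<open>The constant \<open>C\<close> is the same at all points, so Cauchy in the
        norm of \<open>W0\<close> gives Cauchy for the partials uniformly in space.\<close>
      show "uniformly_Cauchy_on UNIV (\<lambda>n. partial_deriv j (\<lambda>y. w n y $ 1))" for j
      proof (rule uniformly_Cauchy_onI)
        fix \<epsilon> :: real
        assume "\<epsilon> > 0"
        then obtain N where N: "\<And>m n. m \<ge> N \<Longrightarrow> n \<ge> N \<Longrightarrow> ip_norm ip (\<lambda>x. w m x - w n x) < \<epsilon> / C"
          using cauchy[of "\<epsilon> / C"] \<open>C > 0\<close> by auto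
        have "dist (partial_deriv j (\<lambda>y. w m y $ 1) x) (partial_deriv j (\<lambda>y. w n y $ 1) x) < \<epsilon>"
          if "m \<ge> N" "n \<ge> N" for m n x
        proof -
          have "partial_deriv j (\<lambda>y. w m y $ 1) x - partial_deriv j (\<lambda>y. w n y $ 1) x
              = partial_deriv j (\<lambda>y. w m y - w n y) x $ 1"
            by (simp add: partial_deriv_nth partial_deriv_diff diff[OF w])
          also have "\<bar>\<dots>\<bar> \<le> C * ip_norm ip (\<lambda>y. w m y - w n y)"
            by (rule order_trans[OF component_le_norm_cart C[OF diff_mem[OF w w]]])
          also have "\<dots> < \<epsilon>"
            using N[OF that] \<open>C > 0\<close> by (simp add: field_simps)
          finally show ?thesis
            by (simp add: dist_real_def)
        qed
        then show "\<exists>M. \<forall>x\<in>UNIV. \<forall>m\<ge>M. \<forall>n\<ge>M.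
            dist (partial_deriv j (\<lambda>y. w m y $ 1) x) (partial_deriv j (\<lambda>y. w n y $ 1) x) < \<epsilon>"
          by blast
      qed
      \<comment> \<open>Testing \<open>lim\<close> against the kernel function centred at
        \<open>y\<close>: the reproducing property evaluates \<open>w n\<close> at \<open>y\<close>,
        while the functional differentiates the translate of \<phi> at 0, hence the argument
        \<open>- y\<close>.\<close>
      show "(\<lambda>n. w n y $ 1) \<longlonglongrightarrow> partial_deriv i \<phi> (- y)" for y
      proof -
        have "partial_deriv i (\<lambda>z. \<phi> (z - y) *\<^sub>R e) 0 $ 1 = partial_deriv i (\<lambda>z. \<phi> (z - y)) 0"
          using partial_deriv_nth[OF diff[OF mem[of y e]], of i 1 0] by (simp add: e_def axis_def)
        also have "\<dots> = partial_deriv i \<phi> (- y)"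
          using partial_deriv_translate[of i \<phi> y 0] by simp
        finally show ?thesis
          using lim[OF mem[of y e]] by (simp add: reproduce[OF w] e_def inner_axis')
      qed
    qed
    \<comment> \<open>Composing with a second reflection removes the sign in the argument.\<close>
    from differentiable_compose[OF this, of uminus] show ?thesis
      by simp
  qed
qed

section \<open>Radial functions and the double curl\<close>

lemma has_real_derivative_axis_ray:
  fixes f :: "real^3 \<Rightarrow> real"
  assumes "f differentiable (at (r *\<^sub>R axis i 1))"
  shows "((\<lambda>t. f (t *\<^sub>R axis i 1)) has_real_derivative partial_deriv i f (r *\<^sub>R axis i 1)) (at r)"
proof -
  obtain f' where f': "(f has_derivative f') (at (r *\<^sub>R axis i 1))"
    using assms unfolding differentiable_def by blast
  have "((\<lambda>t. t *\<^sub>R axis i 1) has_derivative (\<lambda>t. t *\<^sub>R axis i 1)) (at r)"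
    by (auto intro!: derivative_eq_intros)
  from has_derivative_compose[OF this f'] show ?thesis
    unfolding has_field_derivative_def
    by (simp add: linear_scale[OF has_derivative_linear[OF f']] partial_deriv_has_derivative[OF f']
        mult_commute_abs)
qed

text \<open>Along the ray through the first basis vector, \<phi> restricts to \<open>k\<close> at
  positive parameters, so derivatives of \<open>k\<close> are partial derivatives of \<phi> in that
  direction.\<close>

lemma radial_profile_twice_differentiable:
  fixes \<phi> :: "real^3 \<Rightarrow> real"
  assumes radial: "\<And>x. \<phi> x = k (norm x)"
    and diff: "\<And>x. \<phi> differentiable (at x)"
    and diff2: "\<And>i x. partial_deriv i \<phi> differentiable (at x)"
    and r: "r > 0"
  shows "(k has_real_derivative deriv k r) (at r)"
    and "(deriv k has_real_derivative deriv (deriv k) r) (at r)"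
proof -
  define e :: "real^3" where "e = axis 1 1"
  have k: "(k has_real_derivative partial_deriv 1 \<phi> (t *\<^sub>R e)) (at t)" if "t > 0" for t
  \<comment> \<open>The norm of \<open>t *\<^sub>R e\<close> is the absolute value of
    \<open>t\<close>, so the identification with \<open>k\<close> is made on the open
    half-line.\<close>
  proof (rule has_field_derivative_transform_within_open[where S = "{0<..}"])
    show "((\<lambda>t. \<phi> (t *\<^sub>R e)) has_real_derivative partial_deriv 1 \<phi> (t *\<^sub>R e)) (at t)"
      unfolding e_def by (rule has_real_derivative_axis_ray[OF diff])
  qed (use that in \<open>auto simp: radial e_def norm_axis_1\<close>)
  then show "(k has_real_derivative deriv k r) (at r)"
    using r DERIV_imp_deriv by metis
  have "(deriv k has_real_derivative partial_deriv 1 (partial_deriv 1 \<phi>) (r *\<^sub>R e)) (at r)"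
  proof (rule has_field_derivative_transform_within_open[where S = "{0<..}"])
    show "((\<lambda>t. partial_deriv 1 \<phi> (t *\<^sub>R e)) has_real_derivative
        partial_deriv 1 (partial_deriv 1 \<phi>) (r *\<^sub>R e)) (at r)"
      unfolding e_def by (rule has_real_derivative_axis_ray[OF diff2])
    show "partial_deriv 1 \<phi> (t *\<^sub>R e) = deriv k t" if "t \<in> {0<..}" for t
      using DERIV_imp_deriv[OF k] that by simp
  qed (use r in auto)
  then show "(deriv k has_real_derivative deriv (deriv k) r) (at r)"
    using DERIV_imp_deriv by metis
qed

lemma partial_deriv_radial:
  fixes \<phi> :: "real^3 \<Rightarrow> real"
  assumes radial: "\<And>x. \<phi> x = k (norm x)"
    and k: "(k has_real_derivative k') (at (norm x))"
    and x: "x \<noteq> 0"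
  shows "partial_deriv i \<phi> x = k' * (x $ i / norm x)"
proof -
  have "\<phi> = (\<lambda>x. k (norm x))"
    using radial by (rule ext)
  then have "(\<phi> has_derivative (\<lambda>h. k' * (h \<bullet> sgn x))) (at x)"
    using has_derivative_compose[OF has_derivative_norm[OF x] has_field_derivative_imp_has_derivative[OF k]]
    by simp
  then show ?thesis
    using partial_deriv_has_derivative[of \<phi> _ x i] by (simp add: inner_axis' sgn_div_norm divide_inverse)
qed

text \<open>Product and quotient rules for k'(r) x_i / r. The result is grouped so that the two
  factors are entries of \<open>Pr_par\<close> and \<open>Pr_perp\<close>.\<close>

lemma partial_deriv2_radial:
  fixes \<phi> :: "real^3 \<Rightarrow> real"
  assumes radial: "\<And>x. \<phi> x = k (norm x)"
    and k: "\<And>r. r > 0 \<Longrightarrow> (k has_real_derivative k' r) (at r)"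
    and k': "\<And>r. r > 0 \<Longrightarrow> (k' has_real_derivative k'' r) (at r)"
    and x: "x \<noteq> 0"
  shows "partial_deriv j (partial_deriv i \<phi>) x =
    k'' (norm x) * (x $ i * x $ j / (norm x)\<^sup>2) +
    k' (norm x) / norm x * ((if i = j then 1 else 0) - x $ i * x $ j / (norm x)\<^sup>2)"
proof -
  have k'x: "((\<lambda>y. k' (norm y)) has_derivative (\<lambda>h. k'' (norm x) * (h \<bullet> sgn x))) (at x)"
    using has_derivative_compose[OF has_derivative_norm[OF x]
        has_field_derivative_imp_has_derivative[OF k'[of "norm x"]]] x by simp
  have "((\<lambda>y. y $ i / norm y) has_derivative
      (\<lambda>h. - (x $ i) * (inverse (norm x) * (h \<bullet> sgn x) * inverse (norm x)) + h $ i / norm x)) (at x)"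
    using has_derivative_divide[OF bounded_linear_imp_has_derivative[OF bounded_linear_vec_nth]
        has_derivative_norm[OF x], of i] x by simp
  from has_derivative_mult[OF k'x this]
  have "((\<lambda>y. k' (norm y) * (y $ i / norm y)) has_derivative
      (\<lambda>h. k' (norm x) * (- (x $ i) * (inverse (norm x) * (h \<bullet> sgn x) * inverse (norm x)) + h $ i / norm x)
        + k'' (norm x) * (h \<bullet> sgn x) * (x $ i / norm x))) (at x)" .
  then have "(partial_deriv i \<phi> has_derivative
      (\<lambda>h. k' (norm x) * (- (x $ i) * (inverse (norm x) * (h \<bullet> sgn x) * inverse (norm x)) + h $ i / norm x)
        + k'' (norm x) * (h \<bullet> sgn x) * (x $ i / norm x))) (at x)"
  \<comment> \<open>The closed formula for the first partial holds away from the origin, which is an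
    open neighbourhood of \<open>x\<close>.\<close>
  proof (rule has_derivative_transform_within_open[where s = "- {0}"])
    show "k' (norm y) * (y $ i / norm y) = partial_deriv i \<phi> y" if "y \<in> - {0}" for y
      using that partial_deriv_radial[OF radial k[of "norm y"]] by simp
  qed (use x in auto)
  moreover have "axis j 1 $ i = (if i = j then 1 else (0::real))"
    by (simp add: axis_def)
  ultimately show ?thesis
    using x by (simp add: partial_deriv_has_derivative inner_axis' sgn_div_norm field_simps power2_eq_square)
qed

text \<open>Row i of the inner matrix is grad \<phi> x e_i, so by antisymmetry its column j is
  -curl(\<phi> e_j). The identity curl curl = grad div - Laplace then gives the entries; the proof
  checks all nine, pulling signs out of the outer derivative.\<close>

lemma curl_C_curl_R_scalar:
  fixes \<phi> :: "real^3 \<Rightarrow> real"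
  assumes diff2: "\<And>i x. partial_deriv i \<phi> differentiable (at x)"
  shows "curl_C (curl_R (\<lambda>x. \<phi> x *\<^sub>R mat 1)) x $ i $ j =
    (if i = j then \<Sum>l\<in>UNIV. partial_deriv l (partial_deriv l \<phi>) x else 0)
      - partial_deriv j (partial_deriv i \<phi>) x"
  using exhaust_3[of i] exhaust_3[of j]
  by (auto simp: curl_C_def curl_R_def curl_def column_def row_def mat_def sum_3 vector_3
      partial_deriv_minus[OF diff2])

lemma Pr_par_nth: "Pr_par x $ i $ j = x $ i * x $ j / (norm x)\<^sup>2"
  by (simp add: Pr_par_def matrix_matrix_mult_def columnvector_def rowvector_def UNIV_1)

lemma Pr_perp_eq: "Pr_perp x = mat 1 - Pr_par x"
  by (simp add: Pr_perp_def Pr_par_def)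

text \<open>\<open>deriv\<close> and \<open>partial_deriv\<close> are total operators, so the
  differentiability conjuncts certify that the formula speaks of genuine derivatives.\<close>

theorem proposition4p14:
  fixes s :: nat
    and W0 :: "(real^3 \<Rightarrow> real^3) set"
    and ip :: "(real^3 \<Rightarrow> real^3) \<Rightarrow> (real^3 \<Rightarrow> real^3) \<Rightarrow> real"
    and K :: "real^3 \<Rightarrow> real^3 \<Rightarrow> real^3^3"
    and kW kV :: "real^3 \<Rightarrow> real^3^3"
    and k kV_par kV_perp :: "real \<Rightarrow> real"
  assumes "s \<ge> 1"
    and "function_hilbert_space W0 ip"
    and "continuously_included W0 (ip_norm ip) (C0_space s) (C0_norm s)"
    and "is_reproducing_kernel W0 ip K"
    and "\<And>x y. K x y = kW (x - y)"
    and "\<And>x. kW x = k (norm x) *\<^sub>R mat 1"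
    and kV: "\<And>x. kV x = - curl_C (curl_R kW) x"
    and kV_par: "\<And>r. r > 0 \<Longrightarrow> kV_par r = - (2 / r) * deriv k r"
    and kV_perp: "\<And>r. r > 0 \<Longrightarrow> kV_perp r = - (1 / r) * deriv k r - deriv (deriv k) r"
  shows "(\<forall>x. kW differentiable (at x)) \<and>
         (\<forall>i x. partial_deriv i kW differentiable (at x)) \<and>
         (\<forall>r>0. k field_differentiable (at r) \<and> deriv k field_differentiable (at r)) \<and>
         (\<forall>x. x \<noteq> 0 \<longrightarrow>
            kV x = kV_par (norm x) *\<^sub>R Pr_par x + kV_perp (norm x) *\<^sub>R Pr_perp x)"
proof -
  define \<phi> where "\<phi> x = k (norm x)" for x :: "real^3"
  have kW: "kW = (\<lambda>x. \<phi> x *\<^sub>R mat 1)"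
    using assms(6) by (simp add: \<phi>_def fun_eq_iff)
  have K: "K x y = \<phi> (x - y) *\<^sub>R mat 1" for x y
    by (simp add: assms(5) kW)
  have diff: "\<phi> differentiable (at x)" and diff2: "partial_deriv i \<phi> differentiable (at x)" for x i
    using scalar_kernel_twice_differentiable[OF assms(2,3,1,4) K] by blast+
  have mat: "(\<lambda>x. f x *\<^sub>R mat 1 :: real^3^3) differentiable (at x)"
    if "f differentiable (at x)" for f :: "real^3 \<Rightarrow> real" and x
    using that by (intro differentiable_scaleR) simp_all
  have "partial_deriv i kW = (\<lambda>x. partial_deriv i \<phi> x *\<^sub>R mat 1)" for i
    using partial_deriv_bounded_linear[OF bounded_linear_scaleR_left diff] by (auto simp: kW)
  then have kW_diff: "kW differentiable (at x)" "partial_deriv i kW differentiable (at x)" for i x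
    using mat[OF diff] mat[OF diff2] by (simp_all add: kW)
  note k = radial_profile_twice_differentiable[OF \<phi>_def diff diff2]
  have "kV x = kV_par (norm x) *\<^sub>R Pr_par x + kV_perp (norm x) *\<^sub>R Pr_perp x" if x: "x \<noteq> 0" for x
  proof -
    let ?r = "norm x"
    let ?hess = "\<lambda>i j. deriv (deriv k) ?r * (x $ i * x $ j / ?r\<^sup>2) +
      deriv k ?r / ?r * ((if i = j then 1 else 0) - x $ i * x $ j / ?r\<^sup>2)"
    have hess: "partial_deriv j (partial_deriv i \<phi>) x = ?hess i j" for i j
      by (rule partial_deriv2_radial[OF \<phi>_def k x])
    have "(\<Sum>l\<in>UNIV. x $ l * x $ l) = ?r\<^sup>2"
      by (simp add: power2_norm_eq_inner inner_vec_def)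
    then have "(\<Sum>l\<in>UNIV. x $ l * x $ l / ?r\<^sup>2) = 1"
      using x by (simp flip: sum_divide_distrib)
    \<comment> \<open>The Laplacian is the trace of the Hessian, and the parallel and perpendicular
      projections have traces 1 and 2.\<close>
    then have laplace: "(\<Sum>l\<in>UNIV. partial_deriv l (partial_deriv l \<phi>) x) =
        deriv (deriv k) ?r + 2 * deriv k ?r / ?r"
      by (simp only: hess refl if_True sum.distrib sum_subtractf flip: sum_distrib_left) simp
    have mat_nth: "(mat 1 :: real^3^3) $ i $ j = (if i = j then 1 else 0)" for i j
      by (simp add: mat_def)
    \<comment> \<open>Subtracting the Laplacian from the Hessian eigenvalues leaves k'' - (k'' +
      2k'/r) = -2k'/r in the parallel direction and k'/r - (k'' + 2k'/r) = -k'/r - k'' in the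
      perpendicular ones.\<close>
    have "kV x $ i $ j = (kV_par ?r *\<^sub>R Pr_par x + kV_perp ?r *\<^sub>R Pr_perp x) $ i $ j" for i j
      using x by (simp add: kV kW curl_C_curl_R_scalar[OF diff2, of x, unfolded laplace, unfolded hess] kV_par kV_perp
          Pr_perp_eq Pr_par_nth mat_nth algebra_simps)
    then show ?thesis
      by (simp add: vec_eq_iff)
  qed
  then show ?thesis
    using kW_diff k field_differentiable_def by blast
qed

end
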